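(* Let $A$ be a real $m\times n$ matrix and $b\in\mathbb{R}^m$. Let $T$ and $R$ be real matrices of dimensions $n\times n$ and $n\times m$, respectively, such that (i) $T+RA=I$; (ii) $Ry\in\mathcal{R}(A^T)$ for every $y\in\mathbb{R}^m$; (iii) $\tilde T:=TP_{\mathcal{R}(A^T)}$ satisfies $\|\tilde T\|<1$. Then the affine operator $Q:\mathbb{R}^n\to\mathbb{R}^n$ defined by $Q(x):=Tx+Rb$ belongs to $\mathcal{F}_2$.
   Context: $\|\cdot\|$ and $\langle\cdot,\cdot\rangle$ are the Euclidean norm and scalar product on $\mathbb{R}^n$; for a matrix, $\|\cdot\|$ is the induced (spectral) norm. $I$ is the identity matrix, $A^T$ is the transpose of $A$, $\mathcal{R}(\cdot)$ denotes the range, and $P_V$ is the orthogonal projection onto a linear subspace $V$. $\mathcal{F}_1$ is the set of continuous operators $Q:\mathbb{R}^n\to\mathbb{R}^n$ such that for all $x,y\in\mathbb{R}^n$: $\|Q(x)-Q(y)\|\le\|x-y\|$; and if $\|Q(x)-Q(y)\|=\|x-y\|$, then $Q(x)-Q(y)=x-y$ and $\langle x-y,Q(y)-y\rangle=0$. $\mathcal{F}_2$ is the set of operators $Q\in\mathcal{F}_1$ such that for all $S\in\mathbb{R}^{n\times n}$ the function $g:\mathbb{R}^n\to\mathbb{R}$, $g(x):=\|x-SQ(x)\|^2$, attains its unconstrained global minimum. *)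

theory Defs
  imports "HOL-Analysis.Analysis"
begin

definition spectral_norm :: "real^'n^'m \<Rightarrow> real" where
  "spectral_norm A = onorm (\<lambda>x. A *v x)"

definition orth_proj :: "'a::euclidean_space set \<Rightarrow> 'a \<Rightarrow> 'a" where
  "orth_proj V x = (THE p. p \<in> V \<and> (\<forall>v\<in>V. orthogonal (x - p) v))"

lemma orth_proj_ex1:
  fixes V :: "'a::euclidean_space set"
  assumes V: "subspace V"
  shows "\<exists>!p. p \<in> V \<and> (\<forall>v\<in>V. orthogonal (x - p) v)"
proof -
  have sp: "span V = V" using V by (simp add: span_eq_iff)
  obtain y z where yz: "y \<in> span V" "\<And>w. w \<in> span V \<Longrightarrow> orthogonal z w" "x = y + z"
    using orthogonal_subspace_decomp_exists[of V x] by blast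
  show ?thesis
  proof (rule ex1I[of _ y])
    show "y \<in> V \<and> (\<forall>v\<in>V. orthogonal (x - y) v)"
      using yz sp by auto
  next
    fix p assume p: "p \<in> V \<and> (\<forall>v\<in>V. orthogonal (x - p) v)"
    have d: "p - y \<in> V" using p yz sp V by (auto intro: subspace_diff)
    have "(x - y) \<bullet> (p - y) = 0" "(x - p) \<bullet> (p - y) = 0"
      using d p yz sp by (auto simp: orthogonal_def)
    then have "(p - y) \<bullet> (p - y) = 0" by (simp add: inner_diff_left)
    then show "p = y" by simp
  qed
qed

lemma orth_proj_in:
  assumes "subspace V" shows "orth_proj V x \<in> V"
  using theI'[OF orth_proj_ex1[OF assms]] unfolding orth_proj_def by blast

lemma orth_proj_orthogonal:
  assumes "subspace V" "v \<in> V" shows "orthogonal (x - orth_proj V x) v"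
  using theI'[OF orth_proj_ex1[OF assms(1)]] assms(2) unfolding orth_proj_def by blast

lemma orth_proj_eqI:
  assumes "subspace V" "p \<in> V" "\<And>v. v \<in> V \<Longrightarrow> orthogonal (x - p) v"
  shows "orth_proj V x = p"
  unfolding orth_proj_def
  using orth_proj_ex1[OF assms(1)] assms(2,3) by (intro the1_equality) auto

lemma linear_orth_proj:
  assumes V: "subspace V" shows "linear (orth_proj V)"
proof (rule linearI)
  have o: "x \<bullet> v - orth_proj V x \<bullet> v = 0" if "v \<in> V" for x v
    using orth_proj_orthogonal[OF V that, of x]
    by (simp only: orthogonal_def inner_diff_left)
  show "orth_proj V (x + y) = orth_proj V x + orth_proj V y" for x y
  proof (rule orth_proj_eqI[OF V])
    show "orth_proj V x + orth_proj V y \<in> V"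
      by (rule subspace_add[OF V orth_proj_in[OF V] orth_proj_in[OF V]])
    fix v assume "v \<in> V"
    from o[OF this, of x] o[OF this, of y]
    show "orthogonal (x + y - (orth_proj V x + orth_proj V y)) v"
      unfolding orthogonal_def inner_diff_left inner_add_left by linarith
  qed
  show "orth_proj V (c *\<^sub>R x) = c *\<^sub>R orth_proj V x" for c x
  proof (rule orth_proj_eqI[OF V])
    show "c *\<^sub>R orth_proj V x \<in> V"
      by (rule subspace_scale[OF V orth_proj_in[OF V]])
    fix v assume "v \<in> V"
    from o[OF this, of x] show "orthogonal (c *\<^sub>R x - c *\<^sub>R orth_proj V x) v"
      unfolding orthogonal_def inner_diff_left inner_scaleR_left by simp
  qed
qed

text \<open>
  The matrix of the orthogonal projection onto \<open>V\<close>. It represents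
  \<^const>\<open>orth_proj\<close> only when \<open>V\<close> is a linear subspace.
\<close>
definition orth_proj_mat :: "(real^'n) set \<Rightarrow> real^'n^'n" where
  "orth_proj_mat V = matrix (orth_proj V)"

lemma orth_proj_mat_mult:
  assumes "subspace V" shows "orth_proj_mat V *v x = orth_proj V x"
  unfolding orth_proj_mat_def by (rule matrix_works) (use linear_orth_proj[OF assms] in \<open>simp add: linear_matrix_vector_mul_eq\<close>)

definition F1 :: "(real^'n \<Rightarrow> real^'n) set" where
  "F1 = {Q. continuous_on UNIV Q \<and>
     (\<forall>x y. norm (Q x - Q y) \<le> norm (x - y) \<and>
       (norm (Q x - Q y) = norm (x - y) \<longrightarrow>
          Q x - Q y = x - y \<and> (x - y) \<bullet> (Q y - y) = 0))}"

definition F2 :: "(real^'n \<Rightarrow> real^'n) set" where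
  "F2 = {Q \<in> F1. \<forall>S :: real^'n^'n.
     \<exists>x0. \<forall>x. (norm (x0 - S *v Q x0))\<^sup>2 \<le> (norm (x - S *v Q x))\<^sup>2}"

end

theory Submission
  imports Defs
begin

text \<open>
  Split \<open>u = p + z\<close> with \<open>p\<close> in the range \<open>V\<close> of \<open>A\<^sup>T\<close> and \<open>z\<close> in \<open>V\<^sup>\<bottom> = ker A\<close>. Since
  \<open>T = I - R A\<close> and \<open>R\<close> maps into \<open>V\<close>, the matrix \<open>T\<close> fixes \<open>z\<close> and maps \<open>V\<close> into itself, where
  it is a strict contraction. By Pythagoras \<open>T\<close> is nonexpansive, with equality of norms only
  for \<open>p = 0\<close>, that is on \<open>ker A\<close>; and \<open>Q y - y = R (b - A y)\<close> lies in \<open>V\<close>, orthogonal to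
  \<open>ker A\<close>. The minimum exists because \<open>x - S Q x\<close> is affine in \<open>x\<close>, so that its values form a closed set.
\<close>

lemma subspace_range_matrix_vector_mult:
  fixes M :: "real^'n^'m"
  shows "subspace (range (\<lambda>x. M *v x))"
  by (simp add: linear_subspace_image)

lemma transpose_mult_inner:
  fixes A :: "real^'n^'m"
  shows "(transpose A *v w) \<bullet> z = w \<bullet> (A *v z)"
  by (simp add: dot_lmul_matrix)

text \<open>Moving \<open>transpose A\<close> across the inner product turns the left side into
  orthogonality of \<open>A *v z\<close> to every \<open>w\<close>; the choice
  \<open>w = A *v z\<close> then forces it to vanish.\<close>

lemma orthogonal_range_transpose_iff:
  fixes A :: "real^'n^'m"
  shows "(\<forall>v \<in> range (\<lambda>w. transpose A *v w). orthogonal z v) \<longleftrightarrow> A *v z = 0"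
proof -
  have "orthogonal z (transpose A *v w) \<longleftrightarrow> orthogonal (A *v z) w" for w
    using transpose_mult_inner[of A w z] by (simp only: orthogonal_def inner_commute)
  moreover have "(\<forall>w. orthogonal (A *v z) w) \<longleftrightarrow> A *v z = 0"
    by (metis orthogonal_self orthogonal_clauses(1) orthogonal_commute)
  ultimately show ?thesis
    by blast
qed

text \<open>A singular \<open>M\<close> rules out a coercivity argument in \<open>x\<close>. Instead
  the range of \<open>M\<close>, a subspace and hence closed, has a point nearest to
  \<open>- c\<close>, and any preimage of that point is a minimizer.\<close>

lemma norm_affine_attains_min:
  fixes M :: "real^'n^'m"
  shows "\<exists>x0. \<forall>x. (norm (M *v x0 + c))\<^sup>2 \<le> (norm (M *v x + c))\<^sup>2"
proof -
  have "closed (range (\<lambda>x. M *v x))"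
    by (rule closed_subspace[OF subspace_range_matrix_vector_mult])
  then obtain v where v: "v \<in> range (\<lambda>x. M *v x)"
    "\<And>w. w \<in> range (\<lambda>x. M *v x) \<Longrightarrow> dist (- c) v \<le> dist (- c) w"
    using distance_attains_inf[of "range (\<lambda>x. M *v x)" "- c"] by (metis empty_iff rangeI)
  then obtain x0 where x0: "v = M *v x0"
    by (elim imageE)
  have d: "dist (- c) w = norm (w + c)" for w
    using dist_norm[of w "- c"] by (simp only: dist_commute diff_minus_eq_add)
  have "norm (M *v x0 + c) \<le> norm (M *v x + c)" for x
    using v(2)[OF rangeI[of _ x]] unfolding d x0 .
  then show ?thesis
    by (intro exI[of _ x0] allI power_mono) simp_all
qed

theorem proposition5:
  fixes A :: "real^'n^'m" and b :: "real^'m"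
    and T :: "real^'n^'n" and R :: "real^'m^'n"
  assumes "T + R ** A = mat 1"
    and "\<And>y. R *v y \<in> range (\<lambda>z. transpose A *v z)"
    and "spectral_norm (T ** orth_proj_mat (range (\<lambda>z. transpose A *v z))) < 1"
  shows "(\<lambda>x. T *v x + R *v b) \<in> F2"
proof -
  define V where "V = range (\<lambda>z. transpose A *v z)"
  define c where "c = spectral_norm (T ** orth_proj_mat V)"
  have V: "subspace V"
    unfolding V_def by (rule subspace_range_matrix_vector_mult)
  have RV: "R *v y \<in> V" for y
    using assms(2) by (simp add: V_def)
  have c: "c < 1"
    using assms(3) by (simp add: c_def V_def)
  have T: "T *v u = u - R *v (A *v u)" for u
  proof -
    have "(T + R ** A) *v u = u" by (simp add: assms(1))
    then show ?thesis
      by (simp add: matrix_vector_mul_assoc algebra_simps)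
  qed
  have bound: "norm (T *v p) \<le> c * norm p" if "p \<in> V" for p
  proof -
    \<comment> \<open>The projection is the identity on \<open>V\<close>, so the norm bound assumed
      for the product with the projection passes to \<open>T\<close> itself there.\<close>
    have "orth_proj V p = p"
      by (rule orth_proj_eqI[OF V that]) (simp add: orthogonal_def)
    then have "T *v p = (T ** orth_proj_mat V) *v p"
      by (simp add: matrix_vector_mul_assoc[symmetric] orth_proj_mat_mult[OF V])
    also have "norm \<dots> \<le> c * norm p"
      unfolding c_def spectral_norm_def by (rule onorm) (rule matrix_vector_mul_bounded_linear)
    finally show ?thesis .
  qed
  have contr: "norm (T *v u) \<le> norm u \<and> (norm (T *v u) = norm u \<longrightarrow> A *v u = 0)" for u
  proof -
    define p where "p = orth_proj V u"
    define z where "z = u - p"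
    have p: "p \<in> V" unfolding p_def by (rule orth_proj_in[OF V])
    have z: "orthogonal z v" if "v \<in> V" for v
      unfolding z_def p_def by (rule orth_proj_orthogonal[OF V that])
    have Az: "A *v z = 0"
      using z orthogonal_range_transpose_iff[of A z] by (simp add: V_def)
    \<comment> \<open>Invariance of \<open>V\<close> keeps \<open>T *v p\<close> orthogonal to
      \<open>z\<close>, so that Pythagoras applies to the image as well.\<close>
    have Tp: "T *v p \<in> V"
      unfolding T[of p] by (rule subspace_diff[OF V p RV])
    have u: "u = z + p" by (simp add: z_def)
    have Tu: "T *v u = z + T *v p"
      by (simp add: u matrix_vector_right_distrib T[of z] Az)
    have nu: "(norm u)\<^sup>2 = (norm z)\<^sup>2 + (norm p)\<^sup>2"
      unfolding u by (rule norm_add_Pythagorean[OF z[OF p]])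
    have nTu: "(norm (T *v u))\<^sup>2 = (norm z)\<^sup>2 + (norm (T *v p))\<^sup>2"
      unfolding Tu by (rule norm_add_Pythagorean[OF z[OF Tp]])
    have le: "norm (T *v p) \<le> norm p"
      using bound[OF p] c mult_right_mono[of c 1 "norm p"] by simp
    have 1: "norm (T *v u) \<le> norm u"
    proof (rule power2_le_imp_le)
      show "(norm (T *v u))\<^sup>2 \<le> (norm u)\<^sup>2"
        unfolding nu nTu using power_mono[OF le norm_ge_zero] by simp
    qed simp
    have "A *v u = 0" if "norm (T *v u) = norm u"
    proof -
      \<comment> \<open>The common term from \<open>z\<close> cancels; with \<open>bound\<close> and
        \<open>c < 1\<close> only \<open>p = 0\<close> remains.\<close>
      have "norm (T *v p) = norm p"
        using nu nTu that by simp
      then have "(1 - c) * norm p \<le> 0"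
        using bound[OF p] by (simp add: algebra_simps)
      then have "p = 0"
        using c by (simp add: mult_le_0_iff)
      then show ?thesis using Az u by simp
    qed
    with 1 show ?thesis by blast
  qed
  define Q where "Q = (\<lambda>x. T *v x + R *v b)"
  have diff: "Q x - Q y = T *v (x - y)" for x y
    by (simp add: Q_def matrix_vector_mult_diff_distrib)
  have "continuous_on UNIV Q"
    unfolding Q_def by (intro continuous_intros)
  moreover have "norm (Q x - Q y) \<le> norm (x - y)" for x y
    using contr[of "x - y"] by (simp add: diff)
  moreover have "Q x - Q y = x - y \<and> (x - y) \<bullet> (Q y - y) = 0"
    if eq: "norm (Q x - Q y) = norm (x - y)" for x y
  proof -
    have ker: "A *v (x - y) = 0"
      using contr[of "x - y"] eq by (simp add: diff)
    have "Q y - y = R *v (b - A *v y)"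
      by (simp add: Q_def T[of y] matrix_vector_mult_diff_distrib)
    then have "Q y - y \<in> V" using RV by simp
    with ker have "(x - y) \<bullet> (Q y - y) = 0"
      using orthogonal_range_transpose_iff[of A "x - y"] by (auto simp: V_def orthogonal_def)
    \<comment> \<open>On the kernel of \<open>A\<close> the correction term of \<open>T\<close>
      vanishes, so \<open>T\<close> fixes \<open>x - y\<close>.\<close>
    then show ?thesis using ker by (simp add: diff T[of "x - y"])
  qed
  ultimately have "Q \<in> F1"
    unfolding F1_def by blast
  moreover have "\<exists>x0. \<forall>x. (norm (x0 - S *v Q x0))\<^sup>2 \<le> (norm (x - S *v Q x))\<^sup>2" for S :: "real^'n^'n"
  proof -
    have "x - S *v Q x = (mat 1 - S ** T) *v x + - (S *v (R *v b))" for x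
      by (simp add: Q_def matrix_vector_right_distrib matrix_vector_mult_diff_rdistrib
          matrix_vector_mul_assoc)
    then show ?thesis
      using norm_affine_attains_min[of "mat 1 - S ** T" "- (S *v (R *v b))"] by simp
  qed
  ultimately show ?thesis
    by (simp add: F2_def Q_def)
qed

end
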